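(* Let $F_r$ be the free group with basis $x_1,\dots,x_r$. Let $w\in F_r$ have cyclically reduced length $\ell$ (i.e. the cyclic reduction of $w$ has length $\ell$). Let $v_1,\dots,v_{\ell+1}$ be a sequence of primitivity-blocking words such that there is no cancellation between adjacent terms of the sequence (in each product $v_iv_{i+1}$, $1\le i\le \ell$), nor between $v_{\ell+1}$ and $v_1$ (in the product $v_{\ell+1}v_1$). Then the word $\prod_{i=1}^{\ell+1}v_i = v_1v_2\cdots v_{\ell+1}$ is $w$-orbit-blocking.
   Context: $F_r$ is the free group of finite rank $r$ with fixed basis $x_1,\dots,x_r$; elements are identified with freely reduced words in the letters $x_i^{\pm1}$, and lengths and subwords (contiguous) refer to these reduced words. For $w\in F_r$, a (freely reduced) word $v$ is $w$-orbit-blocking if for every automorphism $\varphi\in\operatorname{Aut}(F_r)$, $v$ is not a subword of the cyclic reduction of $\varphi(w)$. An element $u\in F_r$ is primitive if some automorphism of $F_r$ takes $x_1$ to $u$. A word is primitivity-blocking if it is $x_1$-orbit-blocking; equivalently, it is not a subword of any cyclically reduced primitive element of $F_r$. *)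

theory Defs
  imports "HOL-Library.Sublist" "HOL-Algebra.Bij"
begin

text \<open>The letter \<open>x\<^sub>i\<close> is \<open>(i, True)\<close> and its inverse is \<open>(i, False)\<close>.\<close>

type_synonym letter = "nat \<times> bool"
type_synonym word = "letter list"

definition inv_letter :: "letter \<Rightarrow> letter" where
  "inv_letter a = (fst a, \<not> snd a)"

definition reduced :: "word \<Rightarrow> bool" where
  "reduced = successively (\<lambda>a b. b \<noteq> inv_letter a)"

fun push :: "letter \<Rightarrow> word \<Rightarrow> word" where
  "push a [] = [a]"
| "push a (b # w) = (if b = inv_letter a then w else a # b # w)"

definition free_reduction :: "word \<Rightarrow> word" where
  "free_reduction w = foldr push w []"

definition free_group :: "nat \<Rightarrow> word monoid" where
  "free_group r =
    \<lparr>carrier = {w. set w \<subseteq> {1..r} \<times> UNIV \<and> reduced w},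
     mult = (\<lambda>u v. free_reduction (u @ v)),
     one = []\<rparr>"

definition generator :: "nat \<Rightarrow> word" where
  "generator i = [(i, True)]"

text \<open>Meant for freely reduced words. No letter is its own inverse, so a one-letter word is never
  shortened.\<close>

function cyclic_reduction :: "word \<Rightarrow> word" where
  "cyclic_reduction w =
    (if w \<noteq> [] \<and> hd w = inv_letter (last w) then cyclic_reduction (butlast (tl w)) else w)"
  by auto
termination
  by (relation "measure length") auto

declare cyclic_reduction.simps [simp del]

definition orbit_blocking :: "nat \<Rightarrow> word \<Rightarrow> word \<Rightarrow> bool" where
  "orbit_blocking r w v \<longleftrightarrow>
    v \<in> carrier (free_group r) \<and>
    (\<forall>\<phi> \<in> auto (free_group r). \<not> sublist v (cyclic_reduction (\<phi> w)))"

definition primitivity_blocking :: "nat \<Rightarrow> word \<Rightarrow> bool" where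
  "primitivity_blocking r v \<longleftrightarrow> orbit_blocking r (generator 1) v"

definition no_cancellation :: "word \<Rightarrow> word \<Rightarrow> bool" where
  "no_cancellation u v \<longleftrightarrow> reduced (u @ v)"

definition group_product :: "('a, 'b) monoid_scheme \<Rightarrow> 'a list \<Rightarrow> 'a" where
  "group_product G us = foldr (mult G) us (one G)"

lemma inv_letter_inv_letter [simp]: "inv_letter (inv_letter a) = a"
  by (simp add: inv_letter_def)

lemma reduced_Nil [simp]: "reduced []"
  by (simp add: reduced_def)

lemma reduced_Cons_Cons [simp]:
  "reduced (a # b # w) \<longleftrightarrow> b \<noteq> inv_letter a \<and> reduced (b # w)"
  by (simp add: reduced_def)

lemma reduced_single [simp]: "reduced [a]"
  by (simp add: reduced_def)

lemma reduced_ConsD: "reduced (a # w) \<Longrightarrow> reduced w"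
  by (cases w) auto

lemma reduced_push: "reduced w \<Longrightarrow> reduced (push a w)"
  by (cases w) (auto dest: reduced_ConsD)

lemma reduced_foldr_push: "reduced w \<Longrightarrow> reduced (foldr push u w)"
  by (induction u) (auto intro: reduced_push)

lemma reduced_free_reduction: "reduced (free_reduction w)"
  by (simp add: free_reduction_def reduced_foldr_push)

lemma push_reduced: "reduced (a # w) \<Longrightarrow> push a w = a # w"
  by (cases w) auto

lemma free_reduction_reduced: "reduced w \<Longrightarrow> free_reduction w = w"
proof (induction w)
  case Nil
  then show ?case by (simp add: free_reduction_def)
next
  case (Cons a w)
  then have "foldr push w [] = w"
    using reduced_ConsD[of a w] by (simp add: free_reduction_def)
  with Cons.prems show ?case by (simp add: free_reduction_def push_reduced)
qed

lemma push_push_inv: "reduced w \<Longrightarrow> push a (push (inv_letter a) w) = w"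
  by (cases w) (auto simp: push_reduced)

lemma foldr_push_free_reduction:
  assumes "reduced w"
  shows "foldr push (free_reduction u) w = foldr push u w"
proof (induction u)
  case Nil
  then show ?case by (simp add: free_reduction_def)
next
  case (Cons a u)
  have *: "free_reduction (a # u) = push a (free_reduction u)"
    by (simp add: free_reduction_def)
  show ?case
  proof (cases "\<exists>ys. free_reduction u = inv_letter a # ys")
    case True
    then obtain ys where ys: "free_reduction u = inv_letter a # ys" by blast
    have "push a (foldr push u w) = push a (push (inv_letter a) (foldr push ys w))"
      using Cons ys by simp
    also have "\<dots> = foldr push ys w"
      by (intro push_push_inv reduced_foldr_push assms)
    finally show ?thesis using * ys by simp
  next
    case False
    then have "push a (free_reduction u) = a # free_reduction u"
      by (cases "free_reduction u") auto
    then show ?thesis using * Cons by simp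
  qed
qed

lemma free_reduction_append_left:
  "free_reduction (free_reduction u @ v) = free_reduction (u @ v)"
  using foldr_push_free_reduction[of "foldr push v []" u]
  by (simp add: free_reduction_def reduced_foldr_push)

lemma free_reduction_append_right:
  "free_reduction (u @ free_reduction v) = free_reduction (u @ v)"
  using free_reduction_reduced[OF reduced_free_reduction, of v]
  by (simp add: free_reduction_def)

lemma set_push: "set (push a w) \<subseteq> insert a (set w)"
  by (cases w) auto

lemma set_free_reduction: "set (free_reduction w) \<subseteq> set w"
  unfolding free_reduction_def
  by (induction w) (use set_push in fastforce)+

lemma free_reduction_inverse: "free_reduction (rev (map inv_letter w) @ w) = []"
proof (induction w)
  case Nil
  then show ?case by (simp add: free_reduction_def)
next
  case (Cons a w)
  have "push (inv_letter a) (push a (foldr push w [])) = foldr push w []"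
    using push_push_inv[of "foldr push w []" "inv_letter a"]
    by (simp add: reduced_foldr_push)
  then show ?case using Cons by (simp add: free_reduction_def)
qed

lemma group_free_group: "group (free_group r)"
proof (rule groupI)
  fix u v assume "u \<in> carrier (free_group r)" "v \<in> carrier (free_group r)"
  then show "u \<otimes>\<^bsub>free_group r\<^esub> v \<in> carrier (free_group r)"
    using set_free_reduction[of "u @ v"]
    by (auto simp: free_group_def reduced_free_reduction)
next
  fix u assume u: "u \<in> carrier (free_group r)"
  let ?v = "free_reduction (rev (map inv_letter u))"
  have "?v \<in> carrier (free_group r)"
    using u set_free_reduction[of "rev (map inv_letter u)"]
    by (fastforce simp: free_group_def reduced_free_reduction inv_letter_def)
  moreover have "?v \<otimes>\<^bsub>free_group r\<^esub> u = \<one>\<^bsub>free_group r\<^esub>"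
    by (simp add: free_group_def free_reduction_append_left free_reduction_inverse)
  ultimately show "\<exists>v\<in>carrier (free_group r). v \<otimes>\<^bsub>free_group r\<^esub> u = \<one>\<^bsub>free_group r\<^esub>"
    by blast
qed (auto simp: free_group_def free_reduction_append_left free_reduction_append_right
       free_reduction_reduced)

end

theory Submission
  imports Defs
begin

text \<open>Conjugate \<open>\<phi>\<close> so that the total length of the images of the generators is minimal; this only
  rotates cyclic reductions. Then every \<open>\<phi> x\<^sub>i\<close> is a subword of a cyclically reduced primitive
  element: if it is not cyclically reduced itself, \<open>\<phi> (x\<^sub>i x\<^sub>j)\<close> is for a suitable \<open>j\<close>. For \<open>w\<close>
  cyclically reduced of length \<open>\<ell>\<close>, the word \<open>\<phi> w\<close> is a product of \<open>\<ell>\<close> such subwords. Free and cyclic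
  reduction only shorten these factors and a rotation cuts at most one of them in two, so at most
  \<open>\<ell> + 1\<close> subwords of cyclically reduced primitive elements remain. If \<open>v\<^sub>1 \<dots> v\<^bsub>\<ell>+1\<^esub>\<close> occurred in
  their product, some \<open>v\<^sub>i\<close> would lie inside a single factor.\<close>

section \<open>Reduced words\<close>

lemma inv_letter_neq [simp]: "inv_letter a \<noteq> a" "a \<noteq> inv_letter a"
  by (auto simp: inv_letter_def prod_eq_iff)

lemma inv_letter_inject [simp]: "inv_letter a = inv_letter b \<longleftrightarrow> a = b"
  by (metis inv_letter_inv_letter)

lemma inv_letter_eq_iff: "inv_letter a = b \<longleftrightarrow> a = inv_letter b"
  by auto

lemma reduced_append_iff:
  "reduced (u @ v) \<longleftrightarrow>
    reduced u \<and> reduced v \<and> (u = [] \<or> v = [] \<or> hd v \<noteq> inv_letter (last u))"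
  by (auto simp: reduced_def successively_append_iff)

lemma reduced_sublist: "reduced w \<Longrightarrow> sublist u w \<Longrightarrow> reduced u"
  by (auto simp: sublist_def reduced_append_iff)

lemma reduced_Cons_iff: "reduced (a # w) \<longleftrightarrow> w = [] \<or> hd w \<noteq> inv_letter a \<and> reduced w"
  by (cases w) auto

lemma reduced_snoc_iff: "reduced (w @ [a]) \<longleftrightarrow> w = [] \<or> last w \<noteq> inv_letter a \<and> reduced w"
  by (auto simp: reduced_append_iff)

text \<open>The formal inverse, a plain list operation whose rules hold for arbitrary words; on the
  carrier it is the group inverse.\<close>

definition word_inv :: "word \<Rightarrow> word" where
  "word_inv w = rev (map inv_letter w)"

lemma word_inv_simps [simp]:
  "word_inv [] = []"
  "word_inv (a # w) = word_inv w @ [inv_letter a]"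
  "word_inv (u @ v) = word_inv v @ word_inv u"
  "word_inv (word_inv w) = w"
  "word_inv w = [] \<longleftrightarrow> w = []"
  by (auto simp: word_inv_def rev_map o_def)

lemma hd_word_inv: "w \<noteq> [] \<Longrightarrow> hd (word_inv w) = inv_letter (last w)"
  by (simp add: word_inv_def hd_rev last_map)

lemma last_word_inv: "w \<noteq> [] \<Longrightarrow> last (word_inv w) = inv_letter (hd w)"
  by (simp add: word_inv_def last_rev hd_map)

lemma reduced_word_inv: "reduced w \<Longrightarrow> reduced (word_inv w)"
  by (induction w) (auto simp: reduced_Cons_iff reduced_snoc_iff last_word_inv inv_letter_eq_iff)

lemma sublist_word_inv: "sublist u w \<Longrightarrow> sublist (word_inv u) (word_inv w)"
  by (auto simp: sublist_def) (metis append.assoc)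

lemma free_reduction_Nil [simp]: "free_reduction [] = []"
  by (simp add: free_reduction_def)

lemma free_reduction_Cons: "free_reduction (a # w) = push a (free_reduction w)"
  by (simp add: free_reduction_def)

lemma free_reduction_append: "free_reduction (u @ v) = foldr push u (free_reduction v)"
  by (simp add: free_reduction_def)

lemma free_reduction_append_both:
  "free_reduction (free_reduction u @ free_reduction v) = free_reduction (u @ v)"
  by (simp add: free_reduction_append_left free_reduction_append_right)

lemma free_reduction_append_middle:
  "free_reduction (u @ free_reduction w @ v) = free_reduction (u @ w @ v)"
  by (metis free_reduction_append_left free_reduction_append_right)

lemma length_free_reduction_le: "length (free_reduction w) \<le> length w"
proof (induction w)
  case (Cons a w)
  have "length (push a u) \<le> Suc (length u)" for u
    by (cases u) auto
  from this[of "free_reduction w"] Cons show ?case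
    by (simp add: free_reduction_Cons)
qed simp

text \<open>One conjugating letter cancels at an end of \<open>u\<close> and the other adds at most
  one letter, so conjugation by \<open>s\<close> cannot lengthen \<open>u\<close>.\<close>

lemma length_conj_le:
  assumes "reduced u" "u \<noteq> []" "hd u = s \<or> last u = inv_letter s"
  shows "length (free_reduction (inv_letter s # u @ [s])) \<le> length u"
  using assms(3)
proof
  assume "hd u = s"
  with assms obtain t where u: "u = s # t" by (cases u) auto
  have "free_reduction (inv_letter s # u @ [s]) = free_reduction (t @ [s])"
    using push_push_inv[of "free_reduction (t @ [s])" "inv_letter s"]
    by (simp add: u free_reduction_Cons reduced_free_reduction)
  with length_free_reduction_le[of "t @ [s]"] show ?thesis by (simp add: u)
next
  assume "last u = inv_letter s"
  with assms obtain t where u: "u = t @ [inv_letter s]" by (metis append_butlast_last_id)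
  have "free_reduction (inv_letter s # u @ [s]) = free_reduction (inv_letter s # t)"
    by (simp add: u free_reduction_Cons free_reduction_append flip: free_reduction_def)
  with length_free_reduction_le[of "inv_letter s # t"] show ?thesis by (simp add: u)
qed

text \<open>Both conjugating letters cancel, so at least two letters are lost; this is the strict
  drop that will contradict minimality.\<close>

lemma length_conj_both_ends:
  assumes "reduced (s # u @ [inv_letter s])"
  shows "length (free_reduction (inv_letter s # (s # u @ [inv_letter s]) @ [s])) \<le> length u"
proof -
  have "free_reduction (inv_letter s # (s # u @ [inv_letter s]) @ [s]) = free_reduction u"
    using push_push_inv[of "free_reduction u" "inv_letter s"]
    by (simp add: free_reduction_Cons free_reduction_append reduced_free_reduction
        flip: free_reduction_def)
  then show ?thesis using length_free_reduction_le[of u] by simp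
qed

text \<open>The letters of \<open>p\<close>, pushed starting from its right end, can first cancel
  into \<open>q\<close>. Once one of them survives, reducedness of \<open>p\<close> keeps the later
  ones from cancelling, so a beginning of \<open>p\<close> and an end of \<open>q\<close>
  remain.\<close>

lemma foldr_push_prefix_suffix:
  assumes "reduced p"
  shows "\<exists>p' q'. foldr push p q = p' @ q' \<and> prefix p' p \<and> suffix q' q"
  using assms
proof (induction p)
  case (Cons a p)
  then obtain p' q' where IH: "foldr push p q = p' @ q'" "prefix p' p" "suffix q' q"
    by (auto dest: reduced_ConsD)
  show ?case
  proof (cases p')
    case Nil
    show ?thesis
    proof (cases q')
      case Nil
      with \<open>p' = []\<close> IH show ?thesis by (intro exI[of _ "[a]"] exI[of _ "[]"]) auto
    next
      case (Cons b q'')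
      show ?thesis
      proof (cases "b = inv_letter a")
        case True
        with \<open>p' = []\<close> IH Cons show ?thesis
          by (intro exI[of _ "[]"] exI[of _ q'']) (auto dest: suffix_ConsD)
      next
        case False
        with \<open>p' = []\<close> IH Cons show ?thesis by (intro exI[of _ "[a]"] exI[of _ q']) auto
      qed
    qed
  next
    case (Cons b p'')
    then have "b \<noteq> inv_letter a"
      using IH(2) \<open>reduced (a # p)\<close> by (auto simp: reduced_Cons_iff prefix_def)
    with Cons IH show ?thesis by (intro exI[of _ "a # p'"] exI[of _ q']) auto
  qed
qed simp

section \<open>Cyclic reduction and conjugation\<close>

lemma cyclic_reduction_id:
  "w = [] \<or> hd w \<noteq> inv_letter (last w) \<Longrightarrow> cyclic_reduction w = w"
  by (subst cyclic_reduction.simps) auto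

lemma cyclic_reduction_Nil [simp]: "cyclic_reduction [] = []"
  by (simp add: cyclic_reduction_id)

lemma cyclic_reduction_conj [simp]:
  "cyclic_reduction (a # w @ [inv_letter a]) = cyclic_reduction w"
  by (subst cyclic_reduction.simps) auto

text \<open>Induction along the peeling of mutually inverse end letters, with words that have no
  such pair as base case.\<close>

lemma cyclic_reduction_induct [case_names reduced conj]:
  assumes "\<And>w. w = [] \<or> hd w \<noteq> inv_letter (last w) \<Longrightarrow> P w"
    and "\<And>a w. P w \<Longrightarrow> P (a # w @ [inv_letter a])"
  shows "P w"
proof (induction w rule: length_induct)
  case (1 w)
  show ?case
  proof (cases "w = [] \<or> hd w \<noteq> inv_letter (last w)")
    case False
    then obtain a u where "w = a # u" by (cases w) auto
    \<comment> \<open>A one-letter word is excluded because no letter is its own inverse.\<close>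
    with False have "u \<noteq> []" by auto
    then obtain u' b where "u = u' @ [b]" by (metis append_butlast_last_id)
    with \<open>w = a # u\<close> False have "w = a # u' @ [inv_letter a]" by auto
    with 1 assms(2) show ?thesis by auto
  qed (use assms(1) in blast)
qed

lemma sublist_cyclic_reduction: "sublist (cyclic_reduction w) w"
proof (induction w rule: cyclic_reduction_induct)
  case (conj a w)
  have "sublist w (a # w @ [inv_letter a])"
    unfolding sublist_def by (metis append_Cons append_Nil)
  with conj show ?case by (metis cyclic_reduction_conj sublist_order.order.trans)
qed (simp add: cyclic_reduction_id)

text \<open>\<open>g\<close> collects the letters peeled off in front; this is an equation of lists,
  without any free reduction.\<close>

lemma conjugate_cyclic_reduction: "\<exists>g. w = g @ cyclic_reduction w @ word_inv g"
proof (induction w rule: cyclic_reduction_induct)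
  case (reduced w)
  then show ?case by (intro exI[of _ "[]"]) (auto simp: cyclic_reduction_id)
next
  case (conj a w)
  then obtain g where "w = g @ cyclic_reduction w @ word_inv g" ..
  then show ?case by (intro exI[of _ "a # g"]) simp
qed

lemma cyclic_reduction_word_inv:
  "cyclic_reduction (word_inv w) = word_inv (cyclic_reduction w)"
proof (induction w rule: cyclic_reduction_induct)
  case (reduced w)
  then have "word_inv w = [] \<or> hd (word_inv w) \<noteq> inv_letter (last (word_inv w))"
    by (auto simp: hd_word_inv last_word_inv)
  with reduced show ?case by (simp add: cyclic_reduction_id)
qed simp

text \<open>For nonempty \<open>w\<close>, four cases by whether \<open>s\<close> cancels with the
  head of \<open>w\<close> and \<open>inv_letter s\<close> with its last letter. If both do, a layer
  is peeled off; if neither does, a layer is added; if only one does, \<open>w\<close> is cyclically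
  reduced and one letter moves to the opposite end.\<close>

lemma cyclic_reduction_conj_letter:
  assumes "reduced w"
  shows "\<exists>k. cyclic_reduction (free_reduction (s # w @ [inv_letter s])) = rotate k (cyclic_reduction w)"
proof (cases "w = []")
  case True
  then show ?thesis by (simp add: free_reduction_Cons)
next
  case False
  show ?thesis
  proof (cases "hd w = inv_letter s")
    case hd: True
    with False obtain u where u: "w = inv_letter s # u" by (cases w) auto
    have red: "reduced u" using assms u by (auto dest: reduced_ConsD)
    have *: "free_reduction (s # w @ [inv_letter s]) = free_reduction (u @ [inv_letter s])"
      using push_push_inv[of "free_reduction (u @ [inv_letter s])" s]
      by (simp add: u free_reduction_Cons reduced_free_reduction)
    show ?thesis
    proof (cases "u \<noteq> [] \<and> last u = s")
      case True
      then obtain t where t: "u = t @ [s]" by (metis append_butlast_last_id)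
      then have "free_reduction (u @ [inv_letter s]) = t"
        using red by (simp add: free_reduction_append free_reduction_Cons)
           (metis free_reduction_def free_reduction_reduced reduced_append_iff)
      moreover have "cyclic_reduction w = cyclic_reduction t"
        using cyclic_reduction_conj[of "inv_letter s" t] by (simp add: u t)
      ultimately show ?thesis using * by (intro exI[of _ 0]) simp
    next
      case False
      then have "reduced (u @ [inv_letter s])" using red by (auto simp: reduced_snoc_iff)
      then have 1: "free_reduction (u @ [inv_letter s]) = u @ [inv_letter s]"
        by (rule free_reduction_reduced)
      have 2: "cyclic_reduction w = inv_letter s # u"
        unfolding u using False by (intro cyclic_reduction_id) auto
      have 3: "cyclic_reduction (u @ [inv_letter s]) = u @ [inv_letter s]"
        using False assms u by (intro cyclic_reduction_id) (auto simp: hd_append reduced_Cons_iff)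
      show ?thesis unfolding * 1 2 3 by (intro exI[of _ 1]) (simp add: rotate1_def)
    qed
  next
    case hd: False
    show ?thesis
    proof (cases "last w = s")
      case True
      with False obtain u where u: "w = u @ [s]" by (metis append_butlast_last_id)
      then have "reduced (s # u)"
        using assms hd False by (auto simp: reduced_Cons_iff reduced_snoc_iff hd_append split: if_splits)
      then have 1: "free_reduction (s # w @ [inv_letter s]) = s # u"
        using free_reduction_reduced[of "s # u"]
        by (simp add: u free_reduction_append free_reduction_Cons) 
           (simp add: free_reduction_def)
      have 2: "cyclic_reduction w = w"
        using hd True by (intro cyclic_reduction_id) auto
      have 3: "cyclic_reduction (s # u) = s # u"
        using assms u by (intro cyclic_reduction_id) (auto simp: reduced_snoc_iff inv_letter_eq_iff)
      have "s # u = rotate (length u) w" by (simp add: u rotate_append)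
      then show ?thesis unfolding 1 2 3 by blast
    next
      case last: False
      have "reduced (s # w @ [inv_letter s])"
        using assms hd last False by (auto simp: reduced_Cons_iff reduced_snoc_iff)
      then show ?thesis
        by (simp add: free_reduction_reduced) (metis id_apply rotate0)
    qed
  qed
qed

text \<open>Conjugation proceeds one letter of \<open>g\<close> at a time, from the inside outwards,
  and the rotations compose.\<close>

lemma cyclic_reduction_free_conj:
  assumes "reduced w"
  shows "\<exists>k. cyclic_reduction (free_reduction (g @ w @ word_inv g)) = rotate k (cyclic_reduction w)"
proof (induction g)
  case Nil
  then show ?case using assms by (simp add: free_reduction_reduced) (metis id_apply rotate0)
next
  case (Cons s g)
  let ?u = "free_reduction (g @ w @ word_inv g)"
  have "free_reduction ((s # g) @ w @ word_inv (s # g)) = free_reduction (s # ?u @ [inv_letter s])"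
    using free_reduction_append_left[of "g @ w @ word_inv g" "[inv_letter s]"]
    by (simp add: free_reduction_Cons)
  then show ?case
    using cyclic_reduction_conj_letter[OF reduced_free_reduction[of "g @ w @ word_inv g"], of s]
      Cons by (auto simp: rotate_rotate)
qed

section \<open>Words covered by few pieces\<close>

text \<open>The pieces are subwords of elements of \<open>U\<close>, as cancellation and cutting
  leave only parts of factors; a bound instead of an exact count makes the notion stable under
  passing to subwords.\<close>

definition covered :: "word set \<Rightarrow> nat \<Rightarrow> word \<Rightarrow> bool" where
  "covered U n w \<longleftrightarrow>
    (\<exists>ps. length ps \<le> n \<and> concat ps = w \<and> (\<forall>p \<in> set ps. \<exists>u \<in> U. sublist p u))"

lemma covered_append: "covered U m u \<Longrightarrow> covered U n v \<Longrightarrow> covered U (m + n) (u @ v)"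
  unfolding covered_def
  by (elim exE conjE, rule_tac x = "ps @ psa" in exI) auto

text \<open>A cut hits at most one piece, and its two parts stay below the same element of
  \<open>U\<close>. The separate bounds by \<open>n\<close> allow one side to be discarded at no
  cost.\<close>

lemma covered_split:
  assumes "covered U n (u @ v)"
  obtains i j where "covered U i u" "covered U j v" "i \<le> n" "j \<le> n" "i + j \<le> Suc n"
proof -
  from assms obtain ps where ps: "length ps \<le> n" "concat ps = u @ v"
      "\<forall>p \<in> set ps. \<exists>u \<in> U. sublist p u"
    unfolding covered_def by blast
  show thesis
  proof (cases "ps = []")
    case True
    with ps have "covered U 0 u" "covered U 0 v" by (auto simp: covered_def)
    then show thesis using that[of 0 0] by simp
  next
    case False
    \<comment> \<open>The cut falls in the piece \<open>p @ p'\<close>, of which either part may be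
      empty.\<close>
    with ps(2) obtain ps1 p p' ps2 where *: "ps = ps1 @ (p @ p') # ps2"
        "u = concat ps1 @ p" "v = p' @ concat ps2"
      by (auto simp: concat_eq_append_conv)
    obtain w where "w \<in> U" "sublist (p @ p') w" using ps(3) * by auto
    then have "sublist p w" "sublist p' w"
      by (meson sublist_append_leftI sublist_append_rightI sublist_order.order.trans)+
    then have "\<forall>q \<in> set (ps1 @ [p]). \<exists>u \<in> U. sublist q u"
        "\<forall>q \<in> set (p' # ps2). \<exists>u \<in> U. sublist q u"
      using ps(3) * \<open>w \<in> U\<close> by auto
    then have "covered U (Suc (length ps1)) u" "covered U (Suc (length ps2)) v"
      unfolding covered_def * by (metis concat.simps concat_append append_Nil2 length_append_singleton order_refl,
        metis concat.simps(2) length_Cons order_refl)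
    then show thesis using that[of "Suc (length ps1)" "Suc (length ps2)"] ps(1) * by simp
  qed
qed

lemma covered_mono: "covered U m w \<Longrightarrow> m \<le> n \<Longrightarrow> covered U n w"
  unfolding covered_def by (elim exE) (rule exI, auto)

text \<open>What lies to the left and to the right is cut off in turn, each time with the one-sided
  bound, so no piece is added.\<close>

lemma covered_sublist:
  assumes "covered U n w" "sublist u w"
  shows "covered U n u"
proof -
  from assms(2) obtain xs ys where "w = xs @ u @ ys" by (auto simp: sublist_def)
  with assms(1) obtain j where j: "covered U j (u @ ys)" "j \<le> n"
    by (metis covered_split)
  from j(1) obtain i where "covered U i u" "i \<le> j"
    by (rule covered_split)
  with j(2) show ?thesis by (metis covered_mono order.trans)
qed

text \<open>A rotation swaps the two sides of a cut, and the cut creates at most one extra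
  piece.\<close>

lemma covered_rotate: "covered U n w \<Longrightarrow> covered U (Suc n) (rotate k w)"
proof -
  assume w: "covered U n w"
  let ?m = "k mod length w"
  have "covered U n (take ?m w @ drop ?m w)" using w by simp
  then obtain i j where "covered U i (take ?m w)" "covered U j (drop ?m w)" "i + j \<le> Suc n"
    by (rule covered_split)
  then have "covered U (j + i) (rotate k w)" "j + i \<le> Suc n"
    unfolding rotate_drop_take by (simp_all add: covered_append)
  then show ?thesis by (rule covered_mono)
qed

text \<open>Multiplying by a further reduced factor on the left keeps a prefix of it and a suffix of
  the word covered so far, so each factor contributes at most one piece.\<close>

lemma covered_free_reduction:
  assumes "\<forall>u \<in> U. reduced u" "set us \<subseteq> U"
  shows "covered U (length us) (free_reduction (concat us))"
  using assms(2)
proof (induction us)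
  case Nil
  then show ?case by (auto simp: covered_def)
next
  case (Cons u us)
  then have "reduced u" and u: "u \<in> U" and IH: "covered U (length us) (free_reduction (concat us))"
    using assms(1) by auto
  then obtain p q where *: "foldr push u (free_reduction (concat us)) = p @ q"
      "prefix p u" "suffix q (free_reduction (concat us))"
    using foldr_push_prefix_suffix by blast
  have "covered U 1 p"
    unfolding covered_def using *(2) u by (intro exI[of _ "[p]"]) (auto intro: prefix_imp_sublist)
  moreover have "covered U (length us) q"
    using IH *(3) by (blast intro: covered_sublist suffix_imp_sublist)
  ultimately have "covered U (1 + length us) (p @ q)" by (rule covered_append)
  with *(1) show ?case by (simp add: free_reduction_append)
qed

text \<open>A pigeonhole argument: too many consecutive factors for each to straddle a piece boundary.\<close>

lemma sublist_concat_pigeonhole: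
  assumes "sublist (concat vs) (concat ps)" "length ps \<le> length vs" "ps \<noteq> []"
  shows "\<exists>v \<in> set vs. \<exists>p \<in> set ps. sublist v p"
  using assms
proof (induction ps arbitrary: vs)
  case (Cons p ps)
  then obtain v vs' where vs: "vs = v # vs'" by (cases vs) auto
  obtain xs ys where eq: "p @ concat ps = xs @ v @ concat vs' @ ys"
    using Cons.prems(1) vs by (auto simp: sublist_def)
  show ?case
  \<comment> \<open>Either the first factor ends inside the first piece, as it must if there is no
    other piece, or the first piece is used up before that. In the latter case both are dropped and
    the counts still compare.\<close>
  proof (cases "length (xs @ v) \<le> length p \<or> ps = []")
    case True
    have "prefix (xs @ v) p"
    proof (cases "ps = []")
      case True
      with eq show ?thesis by (auto simp: prefix_def)
    next
      case False
      with True have "length (xs @ v) \<le> length p" by simp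
      with eq show ?thesis
        by (metis append.assoc prefixI prefix_length_prefix)
    qed
    then have "sublist v p" by (auto simp: prefix_def)
    with vs show ?thesis by auto
  next
    case False
    then have "prefix p (xs @ v)"
      using eq by (metis append.assoc linorder_le_cases prefixI prefix_length_prefix)
    then obtain zs where "xs @ v = p @ zs" by (auto simp: prefix_def)
    with eq have "concat ps = zs @ concat vs' @ ys"
      by (metis append.assoc same_append_eq)
    then have "sublist (concat vs') (concat ps)" by (auto simp: sublist_def)
    with Cons.IH[of vs'] Cons.prems(2) False vs show ?thesis by auto
  qed
qed simp

lemma covered_pigeonhole:
  assumes "covered U n w" "sublist (concat vs) w" "n \<le> length vs" "[] \<notin> set vs" "vs \<noteq> []"
  shows "\<exists>v \<in> set vs. \<exists>u \<in> U. sublist v u"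
proof -
  obtain ps where ps: "length ps \<le> n" "concat ps = w" "\<forall>p \<in> set ps. \<exists>u \<in> U. sublist p u"
    using assms(1) by (auto simp: covered_def)
  \<comment> \<open>A nonempty factor occurs in \<open>w\<close>, which rules out the empty
    cover.\<close>
  have "ps \<noteq> []"
    using ps(2) assms(2,4,5) by (cases vs) auto
  then obtain v p where "v \<in> set vs" "p \<in> set ps" "sublist v p"
    using sublist_concat_pigeonhole[of vs ps] ps assms by auto
  with ps(3) show ?thesis by (meson sublist_order.order.trans)
qed

section \<open>Automorphisms and primitive elements\<close>

text \<open>Members of \<open>auto\<close> are extensional on the carrier, hence the
  restriction.\<close>

lemma restrict_in_auto:
  assumes "group G" "h \<in> hom G G" "bij_betw h (carrier G) (carrier G)"
  shows "restrict h (carrier G) \<in> auto G"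
  using assms group.is_monoid[OF assms(1)]
  by (auto simp: auto_def Bij_def hom_def Pi_iff monoid.m_closed)

lemma autoD:
  assumes "\<phi> \<in> auto G"
  shows "\<phi> \<in> hom G G" "bij_betw \<phi> (carrier G) (carrier G)"
  using assms by (auto simp: auto_def Bij_def)

lemma (in group) compose_in_auto:
  assumes "\<phi> \<in> auto G" "\<psi> \<in> auto G"
  shows "compose (carrier G) \<phi> \<psi> \<in> auto G"
  using assms by (auto simp: auto_def hom_compose compose_Bij)

text \<open>This is \<open>\<psi>\<close> followed by an inner automorphism, whose inverse is
  conjugation by \<open>inv g\<close>.\<close>

lemma (in group) conjugate_in_auto:
  assumes "\<psi> \<in> auto G" "g \<in> carrier G"
  shows "(\<lambda>x\<in>carrier G. g \<otimes> \<psi> x \<otimes> inv g) \<in> auto G"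
proof (rule restrict_in_auto)
  have cancel: "inv g \<otimes> (g \<otimes> z) = z" "g \<otimes> (inv g \<otimes> z) = z" if "z \<in> carrier G" for z
    using that assms(2) by (simp_all flip: m_assoc)
  have "bij_betw (\<lambda>x. g \<otimes> x \<otimes> inv g) (carrier G) (carrier G)"
    using assms(2)
    by (intro bij_betw_byWitness[where f' = "\<lambda>x. inv g \<otimes> x \<otimes> g"])
       (auto simp: m_assoc cancel)
  from bij_betw_trans[OF autoD(2)[OF assms(1)] this]
  show "bij_betw (\<lambda>x. g \<otimes> \<psi> x \<otimes> inv g) (carrier G) (carrier G)"
    by (simp add: o_def)
  show "(\<lambda>x. g \<otimes> \<psi> x \<otimes> inv g) \<in> hom G G"
    using autoD(1)[OF assms(1)] assms(2)
    by (intro homI) (auto simp: hom_mult hom_in_carrier m_assoc cancel)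
qed (rule is_group)

section \<open>The free group and its homomorphisms\<close>

lemma carrier_free_group:
  "w \<in> carrier (free_group r) \<longleftrightarrow> set w \<subseteq> {1..r} \<times> UNIV \<and> reduced w"
  by (simp add: free_group_def)

lemma mult_free_group [simp]: "u \<otimes>\<^bsub>free_group r\<^esub> v = free_reduction (u @ v)"
  by (simp add: free_group_def)

lemma one_free_group [simp]: "\<one>\<^bsub>free_group r\<^esub> = []"
  by (simp add: free_group_def)

lemma letter_in_free_group [simp]: "[a] \<in> carrier (free_group r) \<longleftrightarrow> fst a \<in> {1..r}"
  by (cases a) (auto simp: carrier_free_group)

lemma word_inv_in_free_group:
  "w \<in> carrier (free_group r) \<Longrightarrow> word_inv w \<in> carrier (free_group r)"
  by (auto simp: carrier_free_group reduced_word_inv) (auto simp: word_inv_def inv_letter_def)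

lemma inv_free_group:
  assumes "w \<in> carrier (free_group r)"
  shows "inv\<^bsub>free_group r\<^esub> w = word_inv w"
  using assms free_reduction_inverse[of w]
  by (intro group.inv_equality[OF group_free_group])
     (auto simp: word_inv_in_free_group simp flip: word_inv_def)

lemma free_group_ConsD:
  assumes "a # w \<in> carrier (free_group r)"
  shows "fst a \<in> {1..r}" "w \<in> carrier (free_group r)"
  using assms by (auto simp: carrier_free_group dest: reduced_ConsD)

lemma hom_inv_free_group:
  assumes "\<phi> \<in> hom (free_group r) (free_group r)" "w \<in> carrier (free_group r)"
  shows "\<phi> (word_inv w) = word_inv (\<phi> w)"
proof -
  interpret group_hom "free_group r" "free_group r" \<phi>
    using assms by (simp add: group_hom_def group_hom_axioms_def group_free_group)
  show ?thesis using hom_inv[OF assms(2)] hom_closed[OF assms(2)] assms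
    by (simp add: inv_free_group)
qed

text \<open>A reduced word is the product of its letters. The number of letter images here will
  bound the number of pieces.\<close>

lemma hom_eq_free_reduction_letters:
  assumes "\<phi> \<in> hom (free_group r) (free_group r)" "w \<in> carrier (free_group r)"
  shows "\<phi> w = free_reduction (concat (map (\<lambda>a. \<phi> [a]) w))"
  using assms(2)
proof (induction w)
  case Nil
  show ?case using hom_one[OF assms(1) group_free_group group_free_group] by simp
next
  case (Cons a w)
  then have *: "[a] \<in> carrier (free_group r)" "w \<in> carrier (free_group r)"
    using free_group_ConsD by auto
  have "a # w = [a] \<otimes>\<^bsub>free_group r\<^esub> w"
    using Cons.prems by (simp add: carrier_free_group free_reduction_reduced)
  then have "\<phi> (a # w) = \<phi> [a] \<otimes>\<^bsub>free_group r\<^esub> \<phi> w"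
    using hom_mult[OF assms(1) *] by simp
  with Cons.IH[OF *(2)] show ?case by (simp add: free_reduction_append_right)
qed

text \<open>Uniqueness in the universal property: values on generators fix those on inverse letters,
  hence on all products of letters.\<close>

lemma hom_free_group_eqI:
  assumes "\<phi> \<in> hom (free_group r) (free_group r)" "\<psi> \<in> hom (free_group r) (free_group r)"
    and "\<And>i. i \<in> {1..r} \<Longrightarrow> \<phi> (generator i) = \<psi> (generator i)"
    and "w \<in> carrier (free_group r)"
  shows "\<phi> w = \<psi> w"
proof -
  have "\<phi> [a] = \<psi> [a]" if "a \<in> set w" for a
  proof -
    have i: "fst a \<in> {1..r}" using assms(4) that by (auto simp: carrier_free_group)
    show ?thesis
    proof (cases "snd a")
      case True
      then show ?thesis using assms(3)[OF i] by (cases a) (simp add: generator_def)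
    next
      case False
      then have "[a] = word_inv (generator (fst a))"
        by (cases a) (simp add: generator_def inv_letter_def)
      moreover have "\<phi> (word_inv (generator (fst a))) = \<psi> (word_inv (generator (fst a)))"
        using assms(3)[OF i] i hom_inv_free_group[OF assms(1), of "generator (fst a)"]
          hom_inv_free_group[OF assms(2), of "generator (fst a)"]
        by (simp add: generator_def)
      ultimately show ?thesis by metis
    qed
  qed
  then have "map (\<lambda>a. \<phi> [a]) w = map (\<lambda>a. \<psi> [a]) w" by simp
  then show ?thesis
    by (simp only: hom_eq_free_reduction_letters[OF assms(1,4)]
        hom_eq_free_reduction_letters[OF assms(2,4)])
qed

section \<open>Endomorphisms and automorphisms given by substitution\<close>

definition letter_image :: "(nat \<Rightarrow> word) \<Rightarrow> letter \<Rightarrow> word" where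
  "letter_image f a = (if snd a then f (fst a) else word_inv (f (fst a)))"

text \<open>Existence in the universal property: for \<open>f\<close> with values in the carrier
  this is the endomorphism extending \<open>f\<close>, written as a formula on all words.\<close>

definition substitution :: "(nat \<Rightarrow> word) \<Rightarrow> word \<Rightarrow> word" where
  "substitution f w = free_reduction (concat (map (letter_image f) w))"

lemma letter_image_inv: "letter_image f (inv_letter a) = word_inv (letter_image f a)"
  by (simp add: letter_image_def inv_letter_def)

lemma substitution_append:
  "substitution f (u @ v) = free_reduction (substitution f u @ substitution f v)"
  by (simp add: substitution_def free_reduction_append_both)

text \<open>Substitution respects cancellation: a cancelling pair of letters goes to a word followed
  by its formal inverse, which reduces to \<open>[]\<close>.\<close>

lemma substitution_free_reduction: "substitution f (free_reduction w) = substitution f w"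
proof (induction w)
  case (Cons a w)
  have "substitution f (push a u) = substitution f (a # u)" for u
  proof (cases "\<exists>v. u = inv_letter a # v")
    case True
    then obtain v where u: "u = inv_letter a # v" ..
    let ?x = "letter_image f a" and ?y = "concat (map (letter_image f) v)"
    have "free_reduction (free_reduction (?x @ word_inv ?x) @ ?y) = free_reduction ?y"
      using free_reduction_inverse[of "word_inv ?x"] by (simp flip: word_inv_def)
    then show ?thesis
      by (simp add: u substitution_def letter_image_inv free_reduction_append_left)
  next
    case False
    then have "push a u = a # u" by (cases u) auto
    then show ?thesis by simp
  qed
  then show ?case
    using substitution_append[of f "[a]"] Cons by (metis append_Cons append_Nil free_reduction_Cons)
qed simp

lemma substitution_generator: "reduced (f i) \<Longrightarrow> substitution f (generator i) = f i"
  by (simp add: substitution_def generator_def letter_image_def free_reduction_reduced)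

lemma substitution_hom:
  assumes "\<And>i. i \<in> {1..r} \<Longrightarrow> f i \<in> carrier (free_group r)"
  shows "substitution f \<in> hom (free_group r) (free_group r)"
proof (rule homI)
  fix w assume w: "w \<in> carrier (free_group r)"
  have "set (letter_image f a) \<subseteq> {1..r} \<times> UNIV" if "a \<in> set w" for a
  proof -
    have "f (fst a) \<in> carrier (free_group r)"
      using that w by (intro assms) (auto simp: carrier_free_group)
    with word_inv_in_free_group[OF this] show ?thesis
      by (auto simp: letter_image_def carrier_free_group)
  qed
  then have "set (concat (map (letter_image f) w)) \<subseteq> {1..r} \<times> UNIV" by fastforce
  then show "substitution f w \<in> carrier (free_group r)"
    unfolding substitution_def carrier_free_group
    by (meson set_free_reduction order.trans reduced_free_reduction)
next
  fix u v
  show "substitution f (u \<otimes>\<^bsub>free_group r\<^esub> v) =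
      substitution f u \<otimes>\<^bsub>free_group r\<^esub> substitution f v"
    by (simp add: substitution_free_reduction substitution_append)
qed

text \<open>The square of the substitution fixes the generators, so it is the identity and the map
  is its own inverse. The substitutions below are chosen to be involutions for this reason.\<close>

lemma involution_in_auto:
  assumes "\<And>i. i \<in> {1..r} \<Longrightarrow> f i \<in> carrier (free_group r)"
    and "\<And>i. i \<in> {1..r} \<Longrightarrow> substitution f (f i) = generator i"
  shows "restrict (substitution f) (carrier (free_group r)) \<in> auto (free_group r)"
proof -
  let ?F = "free_group r"
  have hom: "substitution f \<in> hom ?F ?F" using assms(1) by (rule substitution_hom)
  have "substitution f (substitution f w) = w" if w: "w \<in> carrier ?F" for w
  proof -
    have "(substitution f \<circ> substitution f) w = (\<lambda>x. x) w"
    proof (rule hom_free_group_eqI[OF _ _ _ w])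
      show "substitution f \<circ> substitution f \<in> hom ?F ?F"
        using hom_compose[OF hom hom] .
      show "(\<lambda>x. x) \<in> hom ?F ?F" by (auto simp: hom_def)
      show "(substitution f \<circ> substitution f) (generator i) = generator i" if "i \<in> {1..r}" for i
        using assms[OF that] by (simp add: substitution_generator carrier_free_group)
    qed
    then show ?thesis by simp
  qed
  then have "bij_betw (substitution f) (carrier ?F) (carrier ?F)"
    using hom by (intro bij_betw_byWitness[where f' = "substitution f"]) (auto simp: hom_def)
  with hom show ?thesis by (intro restrict_in_auto group_free_group)
qed

section \<open>Primitive elements\<close>

definition primitive :: "nat \<Rightarrow> word \<Rightarrow> bool" where
  "primitive r u \<longleftrightarrow> (\<exists>\<theta> \<in> auto (free_group r). u = \<theta> (generator 1))"

lemma generator_in_free_group: "i \<in> {1..r} \<Longrightarrow> generator i \<in> carrier (free_group r)"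
  by (simp add: generator_def)

lemma primitive_auto:
  assumes "r \<ge> 1" "primitive r u" "\<phi> \<in> auto (free_group r)"
  shows "primitive r (\<phi> u)"
proof -
  obtain \<theta> where \<theta>: "\<theta> \<in> auto (free_group r)" "u = \<theta> (generator 1)"
    using assms(2) by (auto simp: primitive_def)
  then show ?thesis
    unfolding primitive_def using assms
    by (intro bexI[of _ "compose (carrier (free_group r)) \<phi> \<theta>"]
        group.compose_in_auto[OF group_free_group])
       (simp_all add: compose_def generator_in_free_group)
qed

text \<open>The automorphism induced by \<open>f\<close> carries \<open>generator i\<close> to
  \<open>f i\<close>, and automorphisms preserve primitivity.\<close>

lemma primitive_involution:
  assumes "primitive r (generator i)" "i \<in> {1..r}"
    and "\<And>i. i \<in> {1..r} \<Longrightarrow> f i \<in> carrier (free_group r)"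
    and "\<And>i. i \<in> {1..r} \<Longrightarrow> substitution f (f i) = generator i"
  shows "primitive r (f i)"
proof -
  have "f i \<in> carrier (free_group r)" using assms(2) by (rule assms(3))
  then have "substitution f (generator i) = f i"
    by (simp add: substitution_generator carrier_free_group)
  then have "restrict (substitution f) (carrier (free_group r)) (generator i) = f i"
    using generator_in_free_group[OF assms(2)] by simp
  then show ?thesis
    using primitive_auto[OF _ assms(1) involution_in_auto[OF assms(3,4)]] assms(2) by simp
qed

lemma primitive_generator:
  assumes "i \<in> {1..r}"
  shows "primitive r (generator i)"
proof -
  \<comment> \<open>The transposition of \<open>generator 1\<close> and
    \<open>generator i\<close>.\<close>
  define f where "f k = generator (if k = 1 then i else if k = i then 1 else k)" for k
  have "primitive r (generator 1)"
    unfolding primitive_def using assms generator_in_free_group[of 1 r]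
    by (intro bexI[OF _ group.id_in_auto[OF group_free_group]]) simp
  then have "primitive r (f 1)"
    using assms by (rule_tac primitive_involution)
      (auto simp: f_def substitution_def generator_def letter_image_def free_reduction_Cons)
  then show ?thesis by (simp add: f_def)
qed

lemma primitive_letter:
  assumes "fst a \<in> {1..r}"
  shows "primitive r [a]"
proof (cases "snd a")
  case True
  then show ?thesis using primitive_generator[OF assms] by (cases a) (simp add: generator_def)
next
  case False
  \<comment> \<open>The generator with index \<open>fst a\<close> is inverted and all others are
    fixed.\<close>
  define f where "f k = [(k, k \<noteq> fst a)]" for k
  have "primitive r (f (fst a))"
    using primitive_generator[OF assms] assms by (rule primitive_involution)
      (auto simp: f_def substitution_def generator_def letter_image_def free_reduction_Cons
        inv_letter_def)
  then show ?thesis using False by (cases a) (simp add: f_def)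
qed

lemma primitive_two_generators:
  assumes "i \<in> {1..r}" "j \<in> {1..r}" "i \<noteq> j"
  shows "primitive r (generator i @ generator j)"
proof -
  \<comment> \<open>Inverting \<open>generator j\<close> at the same time makes this an involution:
    the image of \<open>generator i @ generator j\<close> reduces to
    \<open>generator i\<close>.\<close>
  define f where "f k = (if k = i then [(i, True), (j, True)] else [(k, k \<noteq> j)])" for k
  have "primitive r (f i)"
    using primitive_generator[OF assms(1)] assms(1) by (rule primitive_involution)
      (use assms in \<open>auto simp: f_def substitution_def generator_def letter_image_def
        free_reduction_Cons inv_letter_def carrier_free_group\<close>)
  then show ?thesis by (simp add: f_def generator_def)
qed

text \<open>An automorphism carrying \<open>generator 1\<close> to \<open>u\<close> carries its
  inverse to \<open>word_inv u\<close>, and the inverse letter is itself primitive.\<close>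

lemma primitive_word_inv:
  assumes "r \<ge> 1" "primitive r u"
  shows "primitive r (word_inv u)"
proof -
  obtain \<theta> where \<theta>: "\<theta> \<in> auto (free_group r)" "u = \<theta> (generator 1)"
    using assms(2) by (auto simp: primitive_def)
  have "word_inv u = \<theta> (word_inv (generator 1))"
    using hom_inv_free_group[OF autoD(1)[OF \<theta>(1)]] assms(1) \<theta>(2)
    by (simp add: generator_in_free_group)
  moreover have "primitive r (word_inv (generator 1))"
    using primitive_letter[of "(1, False)" r] assms(1) by (simp add: generator_def inv_letter_def)
  ultimately show ?thesis using primitive_auto \<theta>(1) assms(1) by simp
qed

lemma primitivity_blockingD:
  "primitivity_blocking r v \<Longrightarrow> primitive r u \<Longrightarrow> \<not> sublist v (cyclic_reduction u)"
  by (auto simp: primitivity_blocking_def orbit_blocking_def primitive_def)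

section \<open>Automorphisms of minimal length\<close>

text \<open>Total length is a natural number, so some conjugate \<open>\<psi>\<close> of
  \<open>\<phi>\<close> minimises it. Conjugating \<open>\<psi>\<close> by a letter gives another
  conjugate of \<open>\<phi>\<close>, which cannot be shorter.\<close>

lemma minimal_conjugate_automorphism:
  assumes "\<phi> \<in> auto (free_group r)"
  obtains \<psi> h where "\<psi> \<in> auto (free_group r)" "h \<in> carrier (free_group r)"
    "\<And>x. x \<in> carrier (free_group r) \<Longrightarrow> \<phi> x = free_reduction (h @ \<psi> x @ word_inv h)"
    "\<And>s. fst s \<in> {1..r} \<Longrightarrow> (\<Sum>i\<in>{1..r}. length (\<psi> (generator i))) \<le>
       (\<Sum>i\<in>{1..r}. length (free_reduction (inv_letter s # \<psi> (generator i) @ [s])))"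
proof -
  let ?F = "free_group r"
  interpret F: group ?F by (rule group_free_group)
  define conj where "conj \<psi> \<longleftrightarrow> \<psi> \<in> auto ?F \<and>
    (\<exists>h \<in> carrier ?F. \<forall>x \<in> carrier ?F. \<phi> x = h \<otimes>\<^bsub>?F\<^esub> (\<psi> x \<otimes>\<^bsub>?F\<^esub> inv\<^bsub>?F\<^esub> h))" for \<psi>
  let ?size = "\<lambda>\<psi>. \<Sum>i\<in>{1..r}. length (\<psi> (generator i) :: word)"
  have \<phi>_closed: "\<phi> x \<in> carrier ?F" if "x \<in> carrier ?F" for x
    using autoD(1)[OF assms] that by (rule hom_in_carrier)
  have "conj \<phi>"
    unfolding conj_def using assms \<phi>_closed by (intro conjI bexI[of _ "\<one>\<^bsub>?F\<^esub>"])
      (auto simp del: mult_free_group one_free_group)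
  then obtain \<psi> where \<psi>: "conj \<psi>" and min: "\<And>\<theta>. conj \<theta> \<Longrightarrow> ?size \<psi> \<le> ?size \<theta>"
    using ex_has_least_nat[of conj \<phi> ?size] by blast
  then obtain h where auto: "\<psi> \<in> auto ?F" and h: "h \<in> carrier ?F" and
    eq: "\<And>x. x \<in> carrier ?F \<Longrightarrow> \<phi> x = h \<otimes>\<^bsub>?F\<^esub> (\<psi> x \<otimes>\<^bsub>?F\<^esub> inv\<^bsub>?F\<^esub> h)"
    unfolding conj_def by blast
  have \<psi>_closed: "\<psi> x \<in> carrier ?F" if "x \<in> carrier ?F" for x
    using autoD(1)[OF auto] that by (rule hom_in_carrier)
  show thesis
  proof (rule that[OF auto h])
    show "\<phi> x = free_reduction (h @ \<psi> x @ word_inv h)" if "x \<in> carrier ?F" for x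
      using eq[OF that] h by (simp add: inv_free_group free_reduction_append_right)
  next
    fix s :: letter assume s: "fst s \<in> {1..r}"
    let ?s = "[s] :: word"
    \<comment> \<open>Conjugation by the inverse of \<open>s\<close>, so that the images become
      \<open>inv_letter s # \<psi> x @ [s]\<close> before reduction.\<close>
    let ?\<theta> = "\<lambda>x\<in>carrier ?F. inv\<^bsub>?F\<^esub> ?s \<otimes>\<^bsub>?F\<^esub> \<psi> x \<otimes>\<^bsub>?F\<^esub> inv\<^bsub>?F\<^esub> (inv\<^bsub>?F\<^esub> ?s)"
    have s': "?s \<in> carrier ?F" using s by simp
    have cancel: "?s \<otimes>\<^bsub>?F\<^esub> (inv\<^bsub>?F\<^esub> ?s \<otimes>\<^bsub>?F\<^esub> z) = z" if "z \<in> carrier ?F" for z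
      using that s' by (simp del: mult_free_group one_free_group flip: F.m_assoc)
    have "conj ?\<theta>"
      unfolding conj_def
    \<comment> \<open>The letter split off from \<open>\<psi>\<close> is absorbed by the conjugator,
      which becomes \<open>h\<close> times \<open>s\<close>.\<close>
    proof (intro conjI bexI[of _ "h \<otimes>\<^bsub>?F\<^esub> ?s"] ballI)
      show "?\<theta> \<in> auto ?F" using auto s' by (intro F.conjugate_in_auto) auto
      show "h \<otimes>\<^bsub>?F\<^esub> ?s \<in> carrier ?F" using h s' by (rule F.m_closed)
      show "\<phi> x = h \<otimes>\<^bsub>?F\<^esub> ?s \<otimes>\<^bsub>?F\<^esub> (?\<theta> x \<otimes>\<^bsub>?F\<^esub> inv\<^bsub>?F\<^esub> (h \<otimes>\<^bsub>?F\<^esub> ?s))"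
        if x: "x \<in> carrier ?F" for x
        using h s' \<psi>_closed[OF x] eq[OF x] x
        by (simp del: mult_free_group letter_in_free_group
            add: F.m_assoc F.inv_mult_group cancel)
    qed
    from min[OF this]
    have "?size \<psi> \<le> ?size ?\<theta>" .
    also have "?size ?\<theta> = (\<Sum>i\<in>{1..r}. length (free_reduction (inv_letter s # \<psi> (generator i) @ [s])))"
    proof (rule sum.cong)
      fix i assume "i \<in> {1..r}"
      then show "length (?\<theta> (generator i)) = length (free_reduction (inv_letter s # \<psi> (generator i) @ [s]))"
        unfolding F.inv_inv[OF s'] using s' generator_in_free_group[of i r]
        by (simp add: inv_free_group free_reduction_append_left del: letter_in_free_group)
    qed simp
    finally show "?size \<psi> \<le> (\<Sum>i\<in>{1..r}. length (free_reduction (inv_letter s # \<psi> (generator i) @ [s])))" .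
  qed
qed

lemma automorphism_nontrivial:
  assumes "\<psi> \<in> auto (free_group r)" "x \<in> carrier (free_group r)" "x \<noteq> []"
  shows "\<psi> x \<noteq> []"
proof
  assume "\<psi> x = []"
  moreover have "\<psi> [] = []"
    using hom_one[OF autoD(1)[OF assms(1)] group_free_group group_free_group] by simp
  moreover have "[] \<in> carrier (free_group r)" by (simp add: carrier_free_group)
  ultimately show False
    using autoD(2)[OF assms(1)] assms(2,3) by (metis bij_betw_imp_inj_on inj_onD)
qed

text \<open>If \<open>\<psi> x\<^sub>i\<close> has the form \<open>s \<dots> s\<^sup>-\<^sup>1\<close>, then by minimality conjugation by \<open>s\<close> must lengthen some
  \<open>\<psi> x\<^sub>j\<close>, which hence neither starts with \<open>s\<close> nor ends with its inverse. So the primitive element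
  \<open>\<psi> (x\<^sub>i x\<^sub>j)\<close> is cyclically reduced and starts with \<open>\<psi> x\<^sub>i\<close>.\<close>

lemma minimal_sublist_primitive:
  assumes \<psi>: "\<psi> \<in> auto (free_group r)"
    and min: "\<And>s. fst s \<in> {1..r} \<Longrightarrow> (\<Sum>i\<in>{1..r}. length (\<psi> (generator i))) \<le>
       (\<Sum>i\<in>{1..r}. length (free_reduction (inv_letter s # \<psi> (generator i) @ [s])))"
    and i: "i \<in> {1..r}"
  shows "\<exists>p. primitive r p \<and> sublist (\<psi> (generator i)) (cyclic_reduction p)"
proof -
  define U where "U j = \<psi> (generator j)" for j
  have U: "U j \<in> carrier (free_group r)" "U j \<noteq> []" if "j \<in> {1..r}" for j
    using generator_in_free_group[OF that] hom_in_carrier[OF autoD(1)[OF \<psi>]]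
      automorphism_nontrivial[OF \<psi>, of "generator j"]
    by (auto simp: U_def generator_def)
  then have red: "reduced (U j)" if "j \<in> {1..r}" for j
    using that by (simp add: carrier_free_group)
  have r: "r \<ge> 1" using i by simp
  have prim: "primitive r (U i)"
    unfolding U_def using r primitive_generator[OF i] \<psi> by (rule primitive_auto)
  show ?thesis
  proof (cases "hd (U i) = inv_letter (last (U i))")
    case False
    then have "cyclic_reduction (U i) = U i" by (simp add: cyclic_reduction_id)
    with prim show ?thesis by (metis U_def sublist_order.order.refl)
  next
    case True
    define s where "s = hd (U i)"
    then have last: "last (U i) = inv_letter s" using True by simp
    have "U i \<noteq> []" using U(2)[OF i] .
    then obtain t where t: "U i = s # t" by (cases "U i") (auto simp: s_def)
    with last have "t \<noteq> []" by auto
    then obtain t' where t': "U i = s # t' @ [inv_letter s]"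
      using t last by (metis append_butlast_last_id last_ConsR)
    have s: "fst s \<in> {1..r}"
      using U(1)[OF i] t by (auto simp: carrier_free_group)
    have "\<exists>j\<in>{1..r}. hd (U j) \<noteq> s \<and> last (U j) \<noteq> inv_letter s"
    proof (rule ccontr)
      assume contra: "\<not> ?thesis"
      \<comment> \<open>Otherwise conjugation by \<open>s\<close> lengthens no image and strictly
        shortens \<open>U i\<close>, where both ends cancel.\<close>
      have "(\<Sum>j\<in>{1..r}. length (free_reduction (inv_letter s # U j @ [s]))) < (\<Sum>j\<in>{1..r}. length (U j))"
      proof (rule sum_strict_mono_ex1)
        show "\<forall>j\<in>{1..r}. length (free_reduction (inv_letter s # U j @ [s])) \<le> length (U j)"
          using contra red U(2) length_conj_le by blast
        show "\<exists>j\<in>{1..r}. length (free_reduction (inv_letter s # U j @ [s])) < length (U j)"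
          using length_conj_both_ends[of s t'] red[OF i] i t' by (intro bexI[of _ i]) auto
      qed simp
      with min[OF s] show False by (simp add: U_def)
    qed
    then obtain j where j: "j \<in> {1..r}" "hd (U j) \<noteq> s" "last (U j) \<noteq> inv_letter s" by blast
    then have "i \<noteq> j" using s_def by auto
    have "reduced (U i @ U j)"
      using red[OF i] red[OF j(1)] j(2) last by (simp add: reduced_append_iff)
    then have "\<psi> (generator i @ generator j) = U i @ U j"
      using hom_mult[OF autoD(1)[OF \<psi>] generator_in_free_group[OF i] generator_in_free_group[OF j(1)]]
        \<open>i \<noteq> j\<close>
      by (simp add: U_def free_reduction_reduced generator_def inv_letter_def)
    moreover have "primitive r (\<psi> (generator i @ generator j))"
      using r primitive_two_generators[OF i j(1) \<open>i \<noteq> j\<close>] \<psi> by (rule primitive_auto)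
    \<comment> \<open>The product starts with \<open>s\<close>, and its last letter, that of
      \<open>U j\<close>, is not \<open>inv_letter s\<close>.\<close>
    moreover have "cyclic_reduction (U i @ U j) = U i @ U j"
      using U(2)[OF j(1)] j(3) t by (intro cyclic_reduction_id) (auto simp: inv_letter_eq_iff)
    ultimately show ?thesis by (metis U_def sublist_append_rightI)
  qed
qed

text \<open>Inverse letters are reduced to generators: inversion preserves primitivity and commutes
  with cyclic reduction.\<close>

lemma minimal_letter_sublist_primitive:
  assumes \<psi>: "\<psi> \<in> auto (free_group r)"
    and min: "\<And>s. fst s \<in> {1..r} \<Longrightarrow> (\<Sum>i\<in>{1..r}. length (\<psi> (generator i))) \<le>
       (\<Sum>i\<in>{1..r}. length (free_reduction (inv_letter s # \<psi> (generator i) @ [s])))"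
    and a: "fst a \<in> {1..r}"
  shows "\<exists>p. primitive r p \<and> sublist (\<psi> [a]) (cyclic_reduction p)"
proof -
  obtain p where p: "primitive r p" "sublist (\<psi> (generator (fst a))) (cyclic_reduction p)"
    using minimal_sublist_primitive[OF assms] by blast
  show ?thesis
  proof (cases "snd a")
    case True
    then have "[a] = generator (fst a)" by (cases a) (simp add: generator_def)
    with p show ?thesis by metis
  next
    case False
    then have "[a] = word_inv (generator (fst a))"
      by (cases a) (simp add: generator_def inv_letter_def)
    then have "\<psi> [a] = word_inv (\<psi> (generator (fst a)))"
      using hom_inv_free_group[OF autoD(1)[OF \<psi>] generator_in_free_group[OF a]] by metis
    moreover have "primitive r (word_inv p)"
      using p(1) a by (intro primitive_word_inv) auto
    ultimately show ?thesis
      using sublist_word_inv[OF p(2)] by (metis cyclic_reduction_word_inv)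
  qed
qed

text \<open>Each letter of the cyclic reduction of \<open>w\<close> contributes at most one piece to
  its image under a minimal \<open>\<psi>\<close>; going back to \<open>\<phi> w\<close> costs only
  a rotation.\<close>

lemma automorphism_cyclic_reduction_covered:
  assumes "w \<in> carrier (free_group r)" "\<phi> \<in> auto (free_group r)"
  shows "covered {u. \<exists>p. primitive r p \<and> sublist u (cyclic_reduction p)}
    (Suc (length (cyclic_reduction w))) (cyclic_reduction (\<phi> w))"
proof -
  let ?F = "free_group r" and ?c = "cyclic_reduction w"
  obtain \<psi> h where \<psi>: "\<psi> \<in> auto ?F" and h: "h \<in> carrier ?F"
    and eq: "\<And>x. x \<in> carrier ?F \<Longrightarrow> \<phi> x = free_reduction (h @ \<psi> x @ word_inv h)"
    and min: "\<And>s. fst s \<in> {1..r} \<Longrightarrow> (\<Sum>i\<in>{1..r}. length (\<psi> (generator i))) \<le>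
       (\<Sum>i\<in>{1..r}. length (free_reduction (inv_letter s # \<psi> (generator i) @ [s])))"
    by (rule minimal_conjugate_automorphism[OF assms(2)]) blast
  have hom: "\<psi> \<in> hom ?F ?F" using \<psi> by (rule autoD)
  \<comment> \<open>Passing to the cyclic reduction of \<open>w\<close> makes its length, and not
    that of \<open>w\<close>, the number of factors.\<close>
  obtain g where g: "w = g @ ?c @ word_inv g"
    using conjugate_cyclic_reduction by blast
  then have "sublist g w" by (metis sublist_append_rightI)
  then have gc: "g \<in> carrier ?F" "?c \<in> carrier ?F"
    using assms(1) sublist_cyclic_reduction[of w] reduced_sublist set_mono_sublist
    unfolding carrier_free_group by blast+
  have "free_reduction (g @ ?c @ word_inv g) = w"
    unfolding g[symmetric] using assms(1) by (simp add: carrier_free_group free_reduction_reduced)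
  then have "w = g \<otimes>\<^bsub>?F\<^esub> (?c \<otimes>\<^bsub>?F\<^esub> word_inv g)"
    by (simp add: free_reduction_append_right)
  then have "\<psi> w = \<psi> g \<otimes>\<^bsub>?F\<^esub> (\<psi> ?c \<otimes>\<^bsub>?F\<^esub> word_inv (\<psi> g))"
    using hom_mult[OF hom gc(1) group.is_monoid[OF group_free_group, THEN monoid.m_closed, OF gc(2) word_inv_in_free_group[OF gc(1)]]]
      hom_mult[OF hom gc(2) word_inv_in_free_group[OF gc(1)]] hom_inv_free_group[OF hom gc(1)]
    by metis
  then have "\<psi> w = free_reduction (\<psi> g @ \<psi> ?c @ word_inv (\<psi> g))"
    by (simp add: free_reduction_append_right)
  \<comment> \<open>The conjugator \<open>h\<close> between \<open>\<phi>\<close> and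
    \<open>\<psi>\<close> and the image of \<open>g\<close> merge into one, so a single rotation
    accounts for both.\<close>
  then have "\<phi> w = free_reduction ((h @ \<psi> g) @ \<psi> ?c @ word_inv (h @ \<psi> g))"
    using eq[OF assms(1)]
      free_reduction_append_middle[of h "\<psi> g @ \<psi> ?c @ word_inv (\<psi> g)" "word_inv h"]
    by simp
  moreover have red: "reduced (\<psi> x)" if "x \<in> carrier ?F" for x
    using hom_in_carrier[OF hom that] by (simp add: carrier_free_group)
  ultimately obtain k where k: "cyclic_reduction (\<phi> w) = rotate k (cyclic_reduction (\<psi> ?c))"
    using cyclic_reduction_free_conj[OF red[OF gc(2)]] by metis
  \<comment> \<open>Reducedness is added because \<open>covered_free_reduction\<close> asks for
    reduced factors; it is dropped again at the end.\<close>
  let ?U = "{u. reduced u \<and> (\<exists>p. primitive r p \<and> sublist u (cyclic_reduction p))}"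
  have "set (map (\<lambda>a. \<psi> [a]) ?c) \<subseteq> ?U"
  proof -
    have "\<psi> [a] \<in> ?U" if "a \<in> set ?c" for a
    proof -
      have "fst a \<in> {1..r}" using that gc(2) by (auto simp: carrier_free_group)
      then show ?thesis
        using minimal_letter_sublist_primitive[OF \<psi> min] red[of "[a]"] by simp
    qed
    then show ?thesis by auto
  qed
  then have "covered ?U (length ?c) (\<psi> ?c)"
    using covered_free_reduction[of ?U "map (\<lambda>a. \<psi> [a]) ?c"]
    by (simp add: hom_eq_free_reduction_letters[OF hom gc(2)])
  then have "covered ?U (length ?c) (cyclic_reduction (\<psi> ?c))"
    using sublist_cyclic_reduction by (rule covered_sublist)
  \<comment> \<open>The rotation is the source of the one extra piece.\<close>
  then have "covered ?U (Suc (length ?c)) (cyclic_reduction (\<phi> w))"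
    unfolding k by (rule covered_rotate)
  then show ?thesis unfolding covered_def by blast
qed

section \<open>The product of the blocking words\<close>

lemma group_product_free_group: "group_product (free_group r) us = free_reduction (concat us)"
  by (induction us) (simp_all add: group_product_def free_reduction_append_right)

text \<open>As all factors are nonempty, letters meet only across neighbouring factors; an empty
  factor would bring together letters about which nothing is assumed.\<close>

lemma reduced_concat:
  assumes "successively no_cancellation us" "\<forall>u \<in> set us. reduced u \<and> u \<noteq> []"
  shows "reduced (concat us)"
  using assms
proof (induction us)
  case (Cons u us)
  show ?case
  proof (cases us)
    case Nil
    with Cons.prems show ?thesis by simp
  next
    case (Cons v vs)
    then have "reduced (u @ v)" "v \<noteq> []" "reduced (concat us)"
      using Cons.IH Cons.prems by (auto simp: no_cancellation_def)
    with Cons show ?thesis by (simp add: reduced_append_iff)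
  qed
qed simp

theorem theorem6p1:
  fixes r l :: nat and w :: word and v :: "nat \<Rightarrow> word"
  assumes "w \<in> carrier (free_group r)"
    and "length (cyclic_reduction w) = l"
    and "\<And>i. i \<in> {1..l+1} \<Longrightarrow> primitivity_blocking r (v i)"
    and "\<And>i. i \<in> {1..l} \<Longrightarrow> no_cancellation (v i) (v (i + 1))"
    and "no_cancellation (v (l + 1)) (v 1)"
  shows "orbit_blocking r w (group_product (free_group r) (map v [1..<l+2]))"
proof -
  let ?F = "free_group r" and ?vs = "map v [1..<l+2]"
  have blocking: "primitivity_blocking r u" if "u \<in> set ?vs" for u
    using that assms(3) by auto
  \<comment> \<open>The empty word is a subword of every word, so by testing the identity
    automorphism a blocking word is seen to be nonempty.\<close>
  have vs: "u \<in> carrier ?F" "u \<noteq> []" if "u \<in> set ?vs" for u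
    using blocking[OF that] group.id_in_auto[OF group_free_group]
    by (auto simp: primitivity_blocking_def orbit_blocking_def)
  have "successively no_cancellation ?vs"
    unfolding successively_conv_nth using assms(4) by (auto simp del: upt_Suc)
  moreover have "\<forall>u \<in> set ?vs. reduced u \<and> u \<noteq> []"
    using vs by (auto simp: carrier_free_group)
  ultimately have red: "reduced (concat ?vs)" by (rule reduced_concat)
  \<comment> \<open>Without cancellation the group product is the plain concatenation, to which the
    pigeonhole argument applies.\<close>
  then have prod: "group_product ?F ?vs = concat ?vs"
    by (simp only: group_product_free_group free_reduction_reduced)
  have "set (concat ?vs) \<subseteq> {1..r} \<times> UNIV"
    using vs(1) unfolding set_concat carrier_free_group by (intro UN_least) blast
  with red have "concat ?vs \<in> carrier ?F" by (simp only: carrier_free_group simp_thms)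
  moreover have "\<not> sublist (concat ?vs) (cyclic_reduction (\<phi> w))" if "\<phi> \<in> auto ?F" for \<phi>
  proof
    assume "sublist (concat ?vs) (cyclic_reduction (\<phi> w))"
    \<comment> \<open>There are \<open>l + 1\<close> factors against at most \<open>l + 1\<close>
      pieces, which is just enough for the pigeonhole argument.\<close>
    moreover have "Suc (length (cyclic_reduction w)) \<le> length ?vs"
      using assms(2) by (simp del: upt_Suc)
    moreover have "[] \<notin> set ?vs" using vs(2) by blast
    moreover have "?vs \<noteq> []" by simp
    ultimately have "\<exists>u\<in>set ?vs. \<exists>x\<in>{u. \<exists>p. primitive r p \<and> sublist u (cyclic_reduction p)}. sublist u x"
      by (rule covered_pigeonhole[OF automorphism_cyclic_reduction_covered[OF assms(1) that]])
    then obtain u p where "u \<in> set ?vs" "primitive r p" "sublist u (cyclic_reduction p)"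
      by (auto intro: sublist_order.order.trans simp del: upt_Suc)
    with blocking primitivity_blockingD show False by blast
  qed
  ultimately show ?thesis unfolding orbit_blocking_def prod by blast
qed

end
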